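(* Let $\mathbf{O}$ be an appropriate class of operators such that the function $\delta_1$ and all constant functions in $\mathbb{T}_1$ are $\mathbf{O}$-representable. Let $\mathbf{M}=(M,d,A,\alpha)$ and $\mathbf{M'}=(M',d',A',\alpha')$ be effective metric spaces with $\mathrm{dom}(\alpha),\mathrm{dom}(\alpha')\subseteq\mathbb{N}$, and suppose that for every $a\in A$ and every rational number $q$ there exists an $\mathbf{O}$-representable function in $\mathbb{T}_1$ whose value is $0$ exactly at those $n\in\mathrm{dom}(\alpha)$ satisfying $d(\alpha(n),a)<q$. Then every locally uniformly $\mathbf{O}$-computable partial function from $\mathbf{M}$ to $\mathbf{M'}$ with compact domain is uniformly $\mathbf{O}$-computable.
   Context: $\mathbb{T}_m$ is the set of total functions $\mathbb{N}^m\to\mathbb{N}$; a $k$-ary operator is a map $\mathbb{T}_1^k\to\mathbb{T}_1$; $\check{c}\in\mathbb{T}_1$ is the constant function with value $c$. A class $\mathbf{O}$ of operators is appropriate if: (1) for all $k$ and $i\le k$ the operator $(f_1,\ldots,f_k)\mapsto f_i$ is in $\mathbf{O}$; (2) the operator $F(f_1,f_2)(n)=f_1(f_2(n))$ is in $\mathbf{O}$; (3) if $F$ is $k$-ary in $\mathbf{O}$ and $G_1,\ldots,G_k$ are $l$-ary in $\mathbf{O}$, then $H(g_1,\ldots,g_l)=F(G_1(g_1,\ldots,g_l),\ldots,G_k(g_1,\ldots,g_l))$ is in $\mathbf{O}$; (4) if $F$ is $(k+1)$-ary in $\mathbf{O}$, then $G(f_1,\ldots,f_k)(n)=F(f_1,\ldots,f_k,\check{n})(n)$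 is in $\mathbf{O}$. For $f:\mathbb{N}^k\to\mathbb{N}$, $\mathring{f}(f_1,\ldots,f_k)(n)=f(f_1(n),\ldots,f_k(n))$; $f$ is $\mathbf{O}$-representable if $\mathring{f}\in\mathbf{O}$. $\delta_1(x,y,z)=y$ if $x=0$ and $z$ otherwise. An effective metric space $(M,d,A,\alpha)$ (Weihrauch, Def. 8.1.2) consists of a metric space $(M,d)$, a dense subset $A\subseteq M$ and a notation $\alpha$ of $A$ (surjective partial map onto $A$), here with $\mathrm{dom}(\alpha)\subseteq\mathbb{N}$. An ordinary name of $\xi\in M$ is $f\in\mathbb{T}_1$ with $f(t)\in\mathrm{dom}(\alpha)$ and $d(\alpha(f(t)),\xi)<\frac{1}{t+1}$ for all $t$. A partial function $\theta:D\to M'$, $D\subseteq M$, is uniformly $\mathbf{O}$-computable if there is a unary $T\in\mathbf{O}$ such that whenever $\xi\in D$ and $f$ is an ordinary name of $\xi$, $T(f)$ is an ordinary name of $\theta(\xi)$; it is locally uniformly $\mathbf{O}$-computable if every point of $D$ has a neighbourhood $U$ in $M$ such that the restriction of $\theta$ to $D\cap U$ is uniformly $\mathbf{O}$-computable. *)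

theory Defs
  imports "HOL-Analysis.Analysis"
begin

definition tuples :: "nat \<Rightarrow> 'a list set" where
  "tuples k = {xs. length xs = k}"

text \<open>A \<open>k\<close>-ary operator takes a list of \<open>k\<close> functions. It is extensional, so that operators
  are equal iff they agree on all lists of length \<open>k\<close>.\<close>

type_synonym operator = "(nat \<Rightarrow> nat) list \<Rightarrow> (nat \<Rightarrow> nat)"

definition operators :: "nat \<Rightarrow> operator set" where
  "operators k = tuples k \<rightarrow>\<^sub>E UNIV"

text \<open>\<open>\<O> k\<close> is the set of the \<open>k\<close>-ary members of the class. The closure conditions are only
  imposed for positive arities, so no nullary operators are required to be in the class; arguments
  are numbered from \<open>0\<close>.\<close>

definition appropriate :: "(nat \<Rightarrow> operator set) \<Rightarrow> bool" where
  "appropriate \<O> \<longleftrightarrow>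
     (\<forall>k. \<O> k \<subseteq> operators k) \<and>
     (\<forall>k. \<forall>i<k. (\<lambda>fs\<in>tuples k. fs ! i) \<in> \<O> k) \<and>
     (\<lambda>fs\<in>tuples 2. \<lambda>n. (fs ! 0) ((fs ! 1) n)) \<in> \<O> 2 \<and>
     (\<forall>k\<ge>1. \<forall>l\<ge>1. \<forall>F\<in>\<O> k. \<forall>Gs\<in>tuples k. set Gs \<subseteq> \<O> l \<longrightarrow>
        (\<lambda>gs\<in>tuples l. F (map (\<lambda>G. G gs) Gs)) \<in> \<O> l) \<and>
     (\<forall>k\<ge>1. \<forall>F\<in>\<O> (k + 1). (\<lambda>fs\<in>tuples k. \<lambda>n. F (fs @ [\<lambda>_. n]) n) \<in> \<O> k)"

text \<open>The values of \<open>f\<close> matter only on lists of length \<open>k\<close>.\<close>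

definition ring_op :: "nat \<Rightarrow> (nat list \<Rightarrow> nat) \<Rightarrow> operator" where
  "ring_op k f = (\<lambda>fs\<in>tuples k. \<lambda>n. f (map (\<lambda>g. g n) fs))"

definition representable :: "(nat \<Rightarrow> operator set) \<Rightarrow> nat \<Rightarrow> (nat list \<Rightarrow> nat) \<Rightarrow> bool" where
  "representable \<O> k f \<longleftrightarrow> ring_op k f \<in> \<O> k"

abbreviation representable1 :: "(nat \<Rightarrow> operator set) \<Rightarrow> (nat \<Rightarrow> nat) \<Rightarrow> bool" where
  "representable1 \<O> f \<equiv> representable \<O> 1 (\<lambda>xs. f (xs ! 0))"

abbreviation representable3 ::
  "(nat \<Rightarrow> operator set) \<Rightarrow> (nat \<Rightarrow> nat \<Rightarrow> nat \<Rightarrow> nat) \<Rightarrow> bool" where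
  "representable3 \<O> f \<equiv> representable \<O> 3 (\<lambda>xs. f (xs ! 0) (xs ! 1) (xs ! 2))"

definition delta1 :: "nat \<Rightarrow> nat \<Rightarrow> nat \<Rightarrow> nat" where
  "delta1 x y z = (if x = 0 then y else z)"

locale effective_metric_space = Metric_space M d
  for M :: "'a set" and d :: "'a \<Rightarrow> 'a \<Rightarrow> real" +
  fixes A :: "'a set" and \<alpha> :: "nat \<rightharpoonup> 'a"
  assumes subset: "A \<subseteq> M"
    and dense: "mtopology closure_of A = M"
    and notation_onto: "ran \<alpha> = A"

definition ordinary_name ::
  "('a \<Rightarrow> 'a \<Rightarrow> real) \<Rightarrow> (nat \<rightharpoonup> 'a) \<Rightarrow> 'a \<Rightarrow> (nat \<Rightarrow> nat) \<Rightarrow> bool" where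
  "ordinary_name d \<alpha> \<xi> f \<longleftrightarrow>
     (\<forall>t. f t \<in> dom \<alpha> \<and> d (the (\<alpha> (f t))) \<xi> < 1 / (real t + 1))"

definition partial_function_between :: "'a set \<Rightarrow> 'b set \<Rightarrow> ('a \<rightharpoonup> 'b) \<Rightarrow> bool" where
  "partial_function_between M M' \<theta> \<longleftrightarrow> dom \<theta> \<subseteq> M \<and> ran \<theta> \<subseteq> M'"

definition uniformly_computable ::
  "(nat \<Rightarrow> operator set) \<Rightarrow> ('a \<Rightarrow> 'a \<Rightarrow> real) \<Rightarrow> (nat \<rightharpoonup> 'a) \<Rightarrow>
   ('b \<Rightarrow> 'b \<Rightarrow> real) \<Rightarrow> (nat \<rightharpoonup> 'b) \<Rightarrow> ('a \<rightharpoonup> 'b) \<Rightarrow> bool" where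
  "uniformly_computable \<O> d \<alpha> d' \<alpha>' \<theta> \<longleftrightarrow>
     (\<exists>T\<in>\<O> 1. \<forall>\<xi>\<in>dom \<theta>. \<forall>f. ordinary_name d \<alpha> \<xi> f \<longrightarrow>
        ordinary_name d' \<alpha>' (the (\<theta> \<xi>)) (T [f]))"

definition locally_uniformly_computable ::
  "(nat \<Rightarrow> operator set) \<Rightarrow> 'a set \<Rightarrow> ('a \<Rightarrow> 'a \<Rightarrow> real) \<Rightarrow> (nat \<rightharpoonup> 'a) \<Rightarrow>
   ('b \<Rightarrow> 'b \<Rightarrow> real) \<Rightarrow> (nat \<rightharpoonup> 'b) \<Rightarrow> ('a \<rightharpoonup> 'b) \<Rightarrow> bool" where
  "locally_uniformly_computable \<O> M d \<alpha> d' \<alpha>' \<theta> \<longleftrightarrow>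
     (\<forall>x\<in>dom \<theta>. \<exists>U\<subseteq>M. x \<in> Metric_space.mtopology M d interior_of U \<and>
        uniformly_computable \<O> d \<alpha> d' \<alpha>' (\<theta> |` U))"

end

theory Submission
  imports Defs
begin

text \<open>Around every point of the domain there is a ball \<open>B(a, q)\<close> with \<open>a \<in> A\<close> and rational \<open>q\<close>
  such that \<open>\<theta>\<close> is uniformly computable on \<open>B(a, 3q)\<close>. If \<open>f\<close> names \<open>\<xi>\<close> and
  \<open>1/(t+1) < q\<close>, then the representable test \<open>d(\<alpha>(f(t)), a) < 2q\<close> succeeds for all
  \<open>\<xi> \<in> B(a, q)\<close> and only for \<open>\<xi> \<in> B(a, 3q)\<close>. Hence branching on it with \<open>\<delta>\<^sub>1\<close> extends uniform
  computability from any set \<open>V\<close> to \<open>B(a, q) \<union> V\<close>, and by compactness finitely many such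
  extensions exhaust the domain.\<close>

lemma appropriate_compose:
  assumes "appropriate \<O>" "k \<ge> 1" "l \<ge> 1" "F \<in> \<O> k" "length Gs = k" "set Gs \<subseteq> \<O> l"
  shows "(\<lambda>gs\<in>tuples l. F (map (\<lambda>G. G gs) Gs)) \<in> \<O> l"
  using assms unfolding appropriate_def tuples_def by blast

text \<open>Definition by cases inside the class. The function \<open>delta1\<close> acts pointwise,
  but the test \<open>g (f t)\<close> is fed to it as a constant function, so the same branch is
  taken at every argument and the whole function \<open>S [f]\<close> or \<open>T [f]\<close> is
  returned.\<close>

lemma appropriate_branch:
  assumes app: "appropriate \<O>" and delta: "representable3 \<O> delta1"
    and const: "representable1 \<O> (\<lambda>_. t)" and g: "representable1 \<O> g"
    and S: "S \<in> \<O> 1" and T: "T \<in> \<O> 1"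
  obtains H where "H \<in> \<O> 1" "\<And>f. H [f] = (if g (f t) = 0 then S [f] else T [f])"
proof -
  have single: "[f] \<in> tuples 1" for f :: "nat \<Rightarrow> nat"
    by (simp add: tuples_def)
  define P :: operator where "P = (\<lambda>fs\<in>tuples 1. fs ! 0)"
  define C :: operator where "C = (\<lambda>fs\<in>tuples 2. \<lambda>n. (fs ! 0) ((fs ! 1) n))"
  have "P \<in> \<O> 1" "C \<in> \<O> 2"
    using app zero_less_one unfolding appropriate_def P_def C_def by blast+
  \<comment> \<open>Composing \<open>f\<close> with the constant function \<open>t\<close> turns the
    single value \<open>f t\<close> into a constant function.\<close>
  define E where "E = (\<lambda>gs\<in>tuples 1. C (map (\<lambda>G. G gs) [P, ring_op 1 (\<lambda>xs. t)]))"
  have "E \<in> \<O> 1"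
    unfolding E_def using const \<open>P \<in> \<O> 1\<close> \<open>C \<in> \<O> 2\<close>
    by (intro appropriate_compose[OF app, where k = 2]) (auto simp: representable_def)
  define Q where "Q = (\<lambda>gs\<in>tuples 1. ring_op 1 (\<lambda>xs. g (xs ! 0)) (map (\<lambda>G. G gs) [E]))"
  have "Q \<in> \<O> 1"
    unfolding Q_def using g \<open>E \<in> \<O> 1\<close>
    by (intro appropriate_compose[OF app, where k = 1]) (auto simp: representable_def)
  define H where "H = (\<lambda>gs\<in>tuples 1. ring_op 3 (\<lambda>xs. delta1 (xs ! 0) (xs ! 1) (xs ! 2))
    (map (\<lambda>G. G gs) [Q, S, T]))"
  have "H \<in> \<O> 1"
    unfolding H_def using delta S T \<open>Q \<in> \<O> 1\<close>
    by (intro appropriate_compose[OF app, where k = 3]) (auto simp: representable_def)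
  moreover have "E [f] = (\<lambda>_. f t)" for f
    using single by (simp add: E_def P_def C_def ring_op_def) (simp add: tuples_def)
  then have "Q [f] = (\<lambda>_. g (f t))" for f
    using single by (simp add: Q_def ring_op_def)
  then have "H [f] = (if g (f t) = 0 then S [f] else T [f])" for f
    using single by (simp add: H_def ring_op_def delta1_def) (simp add: tuples_def)
  ultimately show thesis
    using that by blast
qed

lemma uniformly_computable_restrict:
  "uniformly_computable \<O> d \<alpha> d' \<alpha>' (\<theta> |` U) \<longleftrightarrow>
     (\<exists>T\<in>\<O> 1. \<forall>\<xi>\<in>dom \<theta> \<inter> U. \<forall>f. ordinary_name d \<alpha> \<xi> f \<longrightarrow>
        ordinary_name d' \<alpha>' (the (\<theta> \<xi>)) (T [f]))"
  unfolding uniformly_computable_def by simp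

lemma uniformly_computable_restrict_ball_Un:
  assumes app: "appropriate \<O>" and delta: "representable3 \<O> delta1"
    and const: "\<forall>c. representable1 \<O> (\<lambda>_. c)"
    and M: "effective_metric_space M d A \<alpha>"
    and g: "representable1 \<O> g" "{n. g n = 0} = {n \<in> dom \<alpha>. d (the (\<alpha> n)) a < 2 * q}"
    and "a \<in> A" "q > 0" "dom \<theta> \<subseteq> M"
    and U: "Metric_space.mball M d a (3 * q) \<subseteq> U" "uniformly_computable \<O> d \<alpha> d' \<alpha>' (\<theta> |` U)"
    and V: "uniformly_computable \<O> d \<alpha> d' \<alpha>' (\<theta> |` V)"
  shows "uniformly_computable \<O> d \<alpha> d' \<alpha>' (\<theta> |` (Metric_space.mball M d a q \<union> V))"
proof -
  interpret effective_metric_space M d A \<alpha> by (rule M)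
  \<comment> \<open>The entry \<open>f t\<close> of any ordinary name then denotes a point at
    distance less than \<open>q\<close> from the named point.\<close>
  obtain t where "1 / real (Suc t) < q"
    using nat_approx_posE[OF \<open>q > 0\<close>] by metis
  then have t: "1 / (real t + 1) < q"
    by (simp add: add.commute)
  obtain S where S: "S \<in> \<O> 1"
    "\<And>\<xi> f. \<xi> \<in> dom \<theta> \<inter> U \<Longrightarrow> ordinary_name d \<alpha> \<xi> f \<Longrightarrow> ordinary_name d' \<alpha>' (the (\<theta> \<xi>)) (S [f])"
    using U(2) unfolding uniformly_computable_restrict by metis
  obtain T where T: "T \<in> \<O> 1"
    "\<And>\<xi> f. \<xi> \<in> dom \<theta> \<inter> V \<Longrightarrow> ordinary_name d \<alpha> \<xi> f \<Longrightarrow> ordinary_name d' \<alpha>' (the (\<theta> \<xi>)) (T [f])"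
    using V unfolding uniformly_computable_restrict by metis
  obtain H where H: "H \<in> \<O> 1" "\<And>f. H [f] = (if g (f t) = 0 then S [f] else T [f])"
    using appropriate_branch[OF app delta _ g(1) S(1) T(1)] const by metis
  have "ordinary_name d' \<alpha>' (the (\<theta> \<xi>)) (H [f])"
    if \<xi>: "\<xi> \<in> dom \<theta> \<inter> (mball a q \<union> V)" and f: "ordinary_name d \<alpha> \<xi> f" for \<xi> f
  proof -
    define b where "b = the (\<alpha> (f t))"
    have ft: "f t \<in> dom \<alpha>" "d b \<xi> < q"
      using f t unfolding ordinary_name_def b_def by (blast, blast intro: less_trans)
    then have "b \<in> A"
      using notation_onto by (auto simp: b_def ran_def)
    then have in_M: "b \<in> M" "a \<in> M" "\<xi> \<in> M"
      using subset \<open>a \<in> A\<close> \<open>dom \<theta> \<subseteq> M\<close> \<xi> by auto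
    \<comment> \<open>The zeros of \<open>g\<close> all lie in the domain of \<alpha>; as
      \<open>f t\<close> lies there too, the test decides the distance.\<close>
    have test: "g (f t) = 0 \<longleftrightarrow> d b a < 2 * q"
      using g(2) ft(1) unfolding b_def by blast
    show ?thesis
    proof (cases "g (f t) = 0")
      case True
      \<comment> \<open>Here 2q + q = 3q. The test alone places \<xi> in \<open>U\<close>, even if
        \<xi> was only known to lie in \<open>V\<close>.\<close>
      have "d a \<xi> \<le> d b a + d b \<xi>"
        using triangle[of a b \<xi>] in_M by (simp add: commute[of b a])
      then have "\<xi> \<in> mball a (3 * q)"
        using True test ft in_M by simp
      then have "\<xi> \<in> dom \<theta> \<inter> U"
        using U(1) \<xi> by blast
      then show ?thesis
        using True S(2) H(2) f by simp
    next
      case False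
      \<comment> \<open>A failed test gives \<open>d b a\<close> at least 2q, while
        \<open>d b \<xi>\<close> is below q, so \<open>d a \<xi>\<close> exceeds q and only
        \<open>V\<close> remains.\<close>
      have "d b a \<le> d b \<xi> + d a \<xi>"
        using triangle[of b \<xi> a] in_M by (simp add: commute[of a \<xi>])
      then have "\<xi> \<notin> mball a q"
        using False test ft by auto
      then have "\<xi> \<in> dom \<theta> \<inter> V"
        using \<xi> by blast
      then show ?thesis
        using False T(2) H(2) f by simp
    qed
  qed
  then show ?thesis
    using H(1) unfolding uniformly_computable_restrict by blast
qed

text \<open>Representable tests are available only for centres in \<open>A\<close> and rational
  radii, so the ball around \<open>x\<close> is replaced by one of this kind.\<close>

lemma (in effective_metric_space) dense_ball_in_neighbourhood:
  assumes "x \<in> mtopology interior_of U"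
  obtains a and q :: rat where
    "a \<in> A" "q > 0" "x \<in> mball a (of_rat q)" "mball a (3 * of_rat q) \<subseteq> U"
proof -
  have "openin mtopology (mtopology interior_of U)"
    by simp
  then obtain r where "r > 0" "mball x r \<subseteq> mtopology interior_of U" and "x \<in> M"
    using assms unfolding openin_mtopology by blast
  then have r: "r > 0" "mball x r \<subseteq> U"
    using interior_of_subset[of mtopology U] by auto
  \<comment> \<open>A quarter of \<open>r\<close> suffices: a point within 3q of \<open>a\<close> is
    within q + 3q = 4q of \<open>x\<close>.\<close>
  obtain q :: rat where q: "0 < real_of_rat q" "real_of_rat q < r / 4"
    using of_rat_dense[of 0 "r / 4"] r(1) by auto
  have "x \<in> mtopology closure_of A"
    using dense \<open>x \<in> M\<close> by simp
  then obtain a where a: "a \<in> A" "a \<in> mball x (of_rat q)"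
    using q(1) unfolding metric_closure_of by blast
  have "mball a (3 * of_rat q) \<subseteq> mball x r"
  proof
    fix y assume "y \<in> mball a (3 * of_rat q)"
    moreover from this have "d x y \<le> d x a + d a y"
      using a(2) by (intro triangle) auto
    ultimately show "y \<in> mball x r"
      using a q by simp
  qed
  then show thesis
    using that[of a q] a q r by (auto simp: commute)
qed

lemma uniformly_computable_restrict_Union:
  assumes "finite \<F>" "uniformly_computable \<O> d \<alpha> d' \<alpha>' (\<theta> |` {})"
    and "\<And>W V. W \<in> \<F> \<Longrightarrow> uniformly_computable \<O> d \<alpha> d' \<alpha>' (\<theta> |` V) \<Longrightarrow>
           uniformly_computable \<O> d \<alpha> d' \<alpha>' (\<theta> |` (W \<union> V))"
  shows "uniformly_computable \<O> d \<alpha> d' \<alpha>' (\<theta> |` \<Union>\<F>)"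
  \<comment> \<open>Simplifying the restriction to the empty set would prevent
    \<open>assms(2)\<close> from matching it.\<close>
  using assms(1,3) by (induction \<F>) (simp_all add: assms(2) del: restrict_map_to_empty)

theorem theorem6:
  fixes \<O> :: "nat \<Rightarrow> operator set"
    and M :: "'a set" and d :: "'a \<Rightarrow> 'a \<Rightarrow> real" and A :: "'a set" and \<alpha> :: "nat \<rightharpoonup> 'a"
    and M' :: "'b set" and d' :: "'b \<Rightarrow> 'b \<Rightarrow> real" and A' :: "'b set" and \<alpha>' :: "nat \<rightharpoonup> 'b"
    and \<theta> :: "'a \<rightharpoonup> 'b"
  assumes "appropriate \<O>"
    and "representable3 \<O> delta1"
    and "\<forall>c::nat. representable1 \<O> (\<lambda>_. c)"
    and "effective_metric_space M d A \<alpha>"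
    and "effective_metric_space M' d' A' \<alpha>'"
    and "\<forall>a\<in>A. \<forall>q::rat. \<exists>g::nat \<Rightarrow> nat. representable1 \<O> g \<and>
           {n. g n = 0} = {n \<in> dom \<alpha>. d (the (\<alpha> n)) a < of_rat q}"
    and "partial_function_between M M' \<theta>"
    and "locally_uniformly_computable \<O> M d \<alpha> d' \<alpha>' \<theta>"
    and "compactin (Metric_space.mtopology M d) (dom \<theta>)"
  shows "uniformly_computable \<O> d \<alpha> d' \<alpha>' \<theta>"
proof -
  interpret effective_metric_space M d A \<alpha> by (rule assms(4))
  let ?UC = "\<lambda>V. uniformly_computable \<O> d \<alpha> d' \<alpha>' (\<theta> |` V)"
  \<comment> \<open>The open sets that can be adjoined to any \<open>V\<close> without losing
    uniform computability. Quantifying over all \<open>V\<close> lets finitely many of them be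
    joined one after another.\<close>
  define \<U> where "\<U> = {W. openin mtopology W \<and> (\<forall>V. ?UC V \<longrightarrow> ?UC (W \<union> V))}"
  have domM: "dom \<theta> \<subseteq> M"
    using assms(7) by (simp add: partial_function_between_def)
  have "\<exists>W\<in>\<U>. x \<in> W" if x: "x \<in> dom \<theta>" for x
  proof -
    obtain U where U: "x \<in> mtopology interior_of U" "?UC U"
      using assms(8) x unfolding locally_uniformly_computable_def by blast
    obtain a and q :: rat where aq: "a \<in> A" "q > 0" "x \<in> mball a (of_rat q)"
      "mball a (3 * of_rat q) \<subseteq> U"
      using dense_ball_in_neighbourhood[OF U(1)] .
    obtain g where g: "representable1 \<O> g"
      "{n. g n = 0} = {n \<in> dom \<alpha>. d (the (\<alpha> n)) a < of_rat (2 * q)}"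
      using assms(6) aq(1) by blast
    have "?UC (mball a (of_rat q) \<union> V)" if "?UC V" for V
      using uniformly_computable_restrict_ball_Un[OF assms(1-4) g(1) _ aq(1) _ domM aq(4) U(2) that]
        g(2) aq(2) by (simp add: of_rat_mult)
    then have "mball a (of_rat q) \<in> \<U>"
      by (simp add: \<U>_def)
    then show ?thesis
      using aq(3) by blast
  qed
  then have "dom \<theta> \<subseteq> \<Union>\<U>" "\<forall>W\<in>\<U>. openin mtopology W"
    by (auto simp: \<U>_def)
  then obtain \<F> where \<F>: "finite \<F>" "\<F> \<subseteq> \<U>" "dom \<theta> \<subseteq> \<Union>\<F>"
    using assms(9) unfolding compactin_def by meson
  \<comment> \<open>On the empty set any unary operator serves vacuously, but one must exist; the
    representability of constants provides it.\<close>
  have "\<O> 1 \<noteq> {}"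
    using assms(3) by (auto simp: representable_def)
  then have "?UC {}"
    unfolding uniformly_computable_restrict by auto
  then have "?UC (\<Union>\<F>)"
    using \<F>(1,2) by (intro uniformly_computable_restrict_Union) (auto simp: \<U>_def)
  then show ?thesis
    using Int_absorb2[OF \<F>(3)]
    unfolding uniformly_computable_restrict unfolding uniformly_computable_def by simp
qed

end
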